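(* Let $(X,T,A)$ be a soft $T_{0U}$ topological space. Then the following statements are equivalent: (a) $(X,T,A)$ is a soft $T_{(0,3^k)}$ space. (b) Both of the following hold: (i) $(X,T,A)$ is a soft $T_{(0,1^k)}$ space; (ii) $(X,T,A)$ is a soft $k$-regular space.
   Context: A soft set over a set $X$ with parameter set $A$ is a pair $(F,A)$ with $F:A\to\mathcal P(X)$; $SS(X)_A$ is the set of all of them. $0_A$ and $1_A$ denote the soft sets with constant value $\emptyset$, respectively $X$. Soft union, soft intersection $\sqcap$, complement $(F,A)^c$ and inclusion $\sqsubseteq$ are defined parameterwise. For $x\in X$, $x\in(F,A)$ means $x\in F(a)$ for all $a\in A$; so $x\in(F,A)^c$ means $x\notin F(a)$ for all $a\in A$. A soft topology on $X$ is a family $T\subseteq SS(X)_A$ containing $0_A,1_A$ and closed under binary soft intersections and arbitrary soft unions; members of $T$ are soft open, their complements are soft closed. A soft neighbourhood of $x$ is a soft set $(F,A)$ such that $x\in(G,A)\sqsubseteq(F,A)$ for some $(G,A)\in T$; $\mathcal U_x$ is the collection of these. Write $x\approx y$ if $x\in(G,A)$ for each $(G,A)\in\mathcal U_y$ and $y\in(F,A)$ for each $(F,A)\in\mathcal U_x$. The space is soft $T_{0U}$ if whenever $x\approx y$, for every $a\in A$ and $(F,A)\in T$: $x\in F(a)$ if and only if $y\in F(a)$. Soft $T_0$ reflection: $X_0$ is the set of equivalence classes of $\approx$ on $X$, $r_X:X\to X_0$ the canonical surjection, and $T_0$ is the soft topology on $X_0$ consisting of those $(F,A)\in SS(X_0)_A$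 for which the soft set $a\mapsto r_X^{-1}(F(a))$ belongs to $T$; $(X_0,T_0,A)$ is the soft $T_0$ reflection of $(X,T,A)$. A soft topological space is soft $T_{1^k}$ if for all distinct points $x,y$ there are soft open sets $(F,A),(G,A)$ with $x\in(F,A)$, $y\in(F,A)^c$, $y\in(G,A)$, $x\in(G,A)^c$. It is soft $k$-regular if for each soft closed $(F,A)$ and each point $x$ with $x\in(F,A)^c$ there are soft open $(G,A),(H,A)$ with $x\in(G,A)$, $(F,A)\sqsubseteq(H,A)$ and $(G,A)\sqcap(H,A)=0_A$. It is soft $T_{3^k}$ if it is soft $k$-regular and soft $T_{1^k}$. $(X,T,A)$ is soft $T_{(0,1^k)}$ (respectively soft $T_{(0,3^k)}$) if $(X_0,T_0,A)$ is soft $T_{1^k}$ (respectively soft $T_{3^k}$). *)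

theory Defs
  imports Main "HOL-Library.FuncSet"
begin

text \<open>The parameter set \<open>A\<close> is fixed, so a soft set \<open>(F,A)\<close> is represented by its
  function \<open>F\<close>. Functions are extensional (\<open>undefined\<close> outside \<open>A\<close>), so that HOL equality of
  soft sets is equality on \<open>A\<close>.\<close>

definition soft_sets :: "'a set \<Rightarrow> 'p set \<Rightarrow> ('p \<Rightarrow> 'a set) set" where
  "soft_sets X A = A \<rightarrow>\<^sub>E Pow X"

definition soft_empty :: "'p set \<Rightarrow> 'p \<Rightarrow> 'a set" where
  "soft_empty A = (\<lambda>a\<in>A. {})"

definition soft_full :: "'a set \<Rightarrow> 'p set \<Rightarrow> 'p \<Rightarrow> 'a set" where
  "soft_full X A = (\<lambda>a\<in>A. X)"

definition soft_Union :: "'p set \<Rightarrow> ('p \<Rightarrow> 'a set) set \<Rightarrow> 'p \<Rightarrow> 'a set" where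
  "soft_Union A S = (\<lambda>a\<in>A. \<Union>F\<in>S. F a)"

definition soft_inter :: "'p set \<Rightarrow> ('p \<Rightarrow> 'a set) \<Rightarrow> ('p \<Rightarrow> 'a set) \<Rightarrow> 'p \<Rightarrow> 'a set" where
  "soft_inter A F G = (\<lambda>a\<in>A. F a \<inter> G a)"

definition soft_compl :: "'a set \<Rightarrow> 'p set \<Rightarrow> ('p \<Rightarrow> 'a set) \<Rightarrow> 'p \<Rightarrow> 'a set" where
  "soft_compl X A F = (\<lambda>a\<in>A. X - F a)"

definition soft_subset :: "'p set \<Rightarrow> ('p \<Rightarrow> 'a set) \<Rightarrow> ('p \<Rightarrow> 'a set) \<Rightarrow> bool" where
  "soft_subset A F G \<longleftrightarrow> (\<forall>a\<in>A. F a \<subseteq> G a)"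

definition soft_mem :: "'p set \<Rightarrow> 'a \<Rightarrow> ('p \<Rightarrow> 'a set) \<Rightarrow> bool" where
  "soft_mem A x F \<longleftrightarrow> (\<forall>a\<in>A. x \<in> F a)"

definition soft_topology :: "'a set \<Rightarrow> 'p set \<Rightarrow> ('p \<Rightarrow> 'a set) set \<Rightarrow> bool" where
  "soft_topology X A T \<longleftrightarrow>
     T \<subseteq> soft_sets X A \<and> soft_empty A \<in> T \<and> soft_full X A \<in> T \<and>
     (\<forall>F\<in>T. \<forall>G\<in>T. soft_inter A F G \<in> T) \<and>
     (\<forall>S. S \<subseteq> T \<longrightarrow> soft_Union A S \<in> T)"

definition soft_closed :: "'a set \<Rightarrow> 'p set \<Rightarrow> ('p \<Rightarrow> 'a set) set \<Rightarrow> ('p \<Rightarrow> 'a set) \<Rightarrow> bool" where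
  "soft_closed X A T F \<longleftrightarrow> (\<exists>G\<in>T. F = soft_compl X A G)"

definition soft_nhds :: "'a set \<Rightarrow> 'p set \<Rightarrow> ('p \<Rightarrow> 'a set) set \<Rightarrow> 'a \<Rightarrow> ('p \<Rightarrow> 'a set) set" where
  "soft_nhds X A T x =
     {F \<in> soft_sets X A. \<exists>G\<in>T. soft_mem A x G \<and> soft_subset A G F}"

definition soft_indist :: "'a set \<Rightarrow> 'p set \<Rightarrow> ('p \<Rightarrow> 'a set) set \<Rightarrow> 'a \<Rightarrow> 'a \<Rightarrow> bool" where
  "soft_indist X A T x y \<longleftrightarrow>
     (\<forall>G\<in>soft_nhds X A T y. soft_mem A x G) \<and> (\<forall>F\<in>soft_nhds X A T x. soft_mem A y F)"

definition soft_T0U :: "'a set \<Rightarrow> 'p set \<Rightarrow> ('p \<Rightarrow> 'a set) set \<Rightarrow> bool" where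
  "soft_T0U X A T \<longleftrightarrow>
     (\<forall>x\<in>X. \<forall>y\<in>X. soft_indist X A T x y \<longrightarrow>
        (\<forall>a\<in>A. \<forall>F\<in>T. x \<in> F a \<longleftrightarrow> y \<in> F a))"

definition soft_T1k :: "'a set \<Rightarrow> 'p set \<Rightarrow> ('p \<Rightarrow> 'a set) set \<Rightarrow> bool" where
  "soft_T1k X A T \<longleftrightarrow>
     (\<forall>x\<in>X. \<forall>y\<in>X. x \<noteq> y \<longrightarrow>
        (\<exists>F\<in>T. \<exists>G\<in>T.
           soft_mem A x F \<and> soft_mem A y (soft_compl X A F) \<and>
           soft_mem A y G \<and> soft_mem A x (soft_compl X A G)))"

definition soft_k_regular :: "'a set \<Rightarrow> 'p set \<Rightarrow> ('p \<Rightarrow> 'a set) set \<Rightarrow> bool" where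
  "soft_k_regular X A T \<longleftrightarrow>
     (\<forall>F. soft_closed X A T F \<longrightarrow>
        (\<forall>x\<in>X. soft_mem A x (soft_compl X A F) \<longrightarrow>
           (\<exists>G\<in>T. \<exists>H\<in>T.
              soft_mem A x G \<and> soft_subset A F H \<and> soft_inter A G H = soft_empty A)))"

definition soft_T3k :: "'a set \<Rightarrow> 'p set \<Rightarrow> ('p \<Rightarrow> 'a set) set \<Rightarrow> bool" where
  "soft_T3k X A T \<longleftrightarrow> soft_k_regular X A T \<and> soft_T1k X A T"

definition soft_indist_rel :: "'a set \<Rightarrow> 'p set \<Rightarrow> ('p \<Rightarrow> 'a set) set \<Rightarrow> ('a \<times> 'a) set" where
  "soft_indist_rel X A T = {(x, y). x \<in> X \<and> y \<in> X \<and> soft_indist X A T x y}"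

definition T0_points :: "'a set \<Rightarrow> 'p set \<Rightarrow> ('p \<Rightarrow> 'a set) set \<Rightarrow> 'a set set" where
  "T0_points X A T = X // soft_indist_rel X A T"

definition T0_proj :: "'a set \<Rightarrow> 'p set \<Rightarrow> ('p \<Rightarrow> 'a set) set \<Rightarrow> 'a \<Rightarrow> 'a set" where
  "T0_proj X A T x = soft_indist_rel X A T `` {x}"

definition T0_topology ::
    "'a set \<Rightarrow> 'p set \<Rightarrow> ('p \<Rightarrow> 'a set) set \<Rightarrow> ('p \<Rightarrow> 'a set set) set" where
  "T0_topology X A T =
     {F \<in> soft_sets (T0_points X A T) A. (\<lambda>a\<in>A. {x \<in> X. T0_proj X A T x \<in> F a}) \<in> T}"

definition soft_T01k :: "'a set \<Rightarrow> 'p set \<Rightarrow> ('p \<Rightarrow> 'a set) set \<Rightarrow> bool" where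
  "soft_T01k X A T \<longleftrightarrow> soft_T1k (T0_points X A T) A (T0_topology X A T)"

definition soft_T03k :: "'a set \<Rightarrow> 'p set \<Rightarrow> ('p \<Rightarrow> 'a set) set \<Rightarrow> bool" where
  "soft_T03k X A T \<longleftrightarrow> soft_T3k (T0_points X A T) A (T0_topology X A T)"

lemma equiv_soft_indist_rel:
  assumes "soft_topology X A T"
  shows "equiv X (soft_indist_rel X A T)"
proof -
  have nhds: "G \<in> soft_nhds X A T x" if "G \<in> T" "soft_mem A x G" for G x
    using that assms unfolding soft_nhds_def soft_topology_def soft_subset_def by auto
  have refl: "soft_mem A x G" if "G \<in> soft_nhds X A T x" for G x
    using that unfolding soft_nhds_def soft_mem_def soft_subset_def by blast
  have step: "soft_mem A x G"
    if xy: "\<forall>G\<in>soft_nhds X A T y. soft_mem A x G"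
      and yz: "\<forall>G\<in>soft_nhds X A T z. soft_mem A y G"
      and G: "G \<in> soft_nhds X A T z" for x y z G
  proof -
    obtain H where H: "H \<in> T" "soft_mem A z H" "soft_subset A H G"
      using G unfolding soft_nhds_def by blast
    then have "soft_mem A x H" using nhds xy yz by blast
    then show ?thesis using H(3) unfolding soft_mem_def soft_subset_def by blast
  qed
  show ?thesis
  proof (rule equivI)
    show "soft_indist_rel X A T \<subseteq> X \<times> X"
      unfolding soft_indist_rel_def by auto
    show "refl_on X (soft_indist_rel X A T)"
      unfolding soft_indist_rel_def soft_indist_def refl_on_def using refl by auto
    show "sym (soft_indist_rel X A T)"
      unfolding soft_indist_rel_def soft_indist_def sym_def by auto
    show "trans (soft_indist_rel X A T)"
    proof (rule transI)
      fix x y z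
      assume "(x, y) \<in> soft_indist_rel X A T" "(y, z) \<in> soft_indist_rel X A T"
      then show "(x, z) \<in> soft_indist_rel X A T"
        using step[of y x z] step[of y z x] unfolding soft_indist_rel_def soft_indist_def by blast
    qed
  qed
qed

lemma soft_topology_T0_topology:
  assumes T: "soft_topology X A T"
  shows "soft_topology (T0_points X A T) A (T0_topology X A T)"
proof -
  let ?X = "T0_points X A T" and ?T = "T0_topology X A T"
  let ?pre = "\<lambda>F. \<lambda>a\<in>A. {x \<in> X. T0_proj X A T x \<in> F a}"
  have proj: "T0_proj X A T x \<in> ?X" if "x \<in> X" for x
    using that unfolding T0_proj_def T0_points_def by (rule quotientI)
  have empty: "?pre (soft_empty A) = soft_empty A"
    by (auto simp: soft_empty_def fun_eq_iff)
  have full: "?pre (soft_full ?X A) = soft_full X A"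
    using proj by (auto simp: soft_full_def fun_eq_iff)
  have inter: "?pre (soft_inter A F G) = soft_inter A (?pre F) (?pre G)" for F G
    by (auto simp: soft_inter_def fun_eq_iff)
  have union: "?pre (soft_Union A S) = soft_Union A (?pre ` S)" for S
    by (auto simp: soft_Union_def fun_eq_iff)
  show ?thesis
    unfolding soft_topology_def
  proof (intro conjI ballI allI impI)
    show "?T \<subseteq> soft_sets ?X A" unfolding T0_topology_def by blast
    show "soft_empty A \<in> ?T"
      using T empty unfolding T0_topology_def soft_topology_def
      by (auto simp: soft_sets_def soft_empty_def)
    show "soft_full ?X A \<in> ?T"
      using T full unfolding T0_topology_def soft_topology_def
      by (auto simp: soft_sets_def soft_full_def)
    show "soft_inter A F G \<in> ?T" if "F \<in> ?T" "G \<in> ?T" for F G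
    proof -
      have "?pre (soft_inter A F G) \<in> T"
        unfolding inter using that T unfolding T0_topology_def soft_topology_def by blast
      moreover have "soft_inter A F G \<in> soft_sets ?X A"
        using that unfolding T0_topology_def soft_sets_def soft_inter_def
        by (auto simp: PiE_iff)
      ultimately show ?thesis unfolding T0_topology_def by blast
    qed
    show "soft_Union A S \<in> ?T" if S: "S \<subseteq> ?T" for S
    proof -
      have "?pre ` S \<subseteq> T" using S unfolding T0_topology_def by blast
      then have "?pre (soft_Union A S) \<in> T"
        unfolding union using T unfolding soft_topology_def by blast
      moreover have "soft_Union A S \<in> soft_sets ?X A"
        using S unfolding T0_topology_def soft_sets_def soft_Union_def
        by (fastforce simp: PiE_iff)
      ultimately show ?thesis unfolding T0_topology_def by blast
    qed
  qed
qed

end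

theory Submission
  imports Defs
begin

text \<open>Soft \<open>T\<^sub>3\<^sub>k\<close> is the conjunction of soft \<open>k\<close>-regularity and soft \<open>T\<^sub>1\<^sub>k\<close>, so the claim
  reduces to this: soft \<open>k\<close>-regularity holds in the space exactly when it holds in its soft
  \<open>T\<^sub>0\<close> reflection.

  The \<open>T\<^sub>0\<^sub>U\<close> hypothesis says that every value \<open>F a\<close> of a soft open set is a union of
  indistinguishability classes. Hence every soft open set is the preimage of a soft open set of
  the reflection (its image), and \<open>T\<close> consists precisely of the preimages of the members of
  \<open>T\<^sub>0\<close> (lemma \<open>soft_preimage_T0_topology\<close>): the space carries the initial soft topology of a
  surjection. Such a surjection preserves and reflects \<open>k\<close>-regularity
  (\<open>soft_k_regular_preimage_iff\<close>), since membership, covering and disjointness can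
  all be tested on preimages. Without the hypothesis a soft open set may split classes at single
  parameters, and such a set is not a preimage from the reflection.\<close>

definition soft_preimage ::
    "'a set \<Rightarrow> 'p set \<Rightarrow> ('a \<Rightarrow> 'b) \<Rightarrow> ('p \<Rightarrow> 'b set) \<Rightarrow> 'p \<Rightarrow> 'a set" where
  "soft_preimage X A r F = (\<lambda>a\<in>A. {x \<in> X. r x \<in> F a})"

text \<open>The usual reformulation of regularity, by passing from a closed soft set to its open
  complement \<open>U\<close>: the open set \<open>H\<close> contains that complement exactly when \<open>U\<close> and \<open>H\<close>
  cover \<open>X\<close> at each parameter. In this form only soft open sets occur.\<close>

lemma soft_k_regular_iff_open:
  assumes "T \<subseteq> soft_sets X A"
  shows "soft_k_regular X A T \<longleftrightarrow>
    (\<forall>U\<in>T. \<forall>x\<in>X. (\<forall>a\<in>A. x \<in> U a) \<longrightarrow>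
      (\<exists>G\<in>T. \<exists>H\<in>T. (\<forall>a\<in>A. x \<in> G a) \<and>
        (\<forall>a\<in>A. \<forall>y\<in>X. (y \<in> U a \<or> y \<in> H a) \<and> \<not> (y \<in> G a \<and> y \<in> H a))))"
proof -
  have mem: "soft_mem A x (soft_compl X A (soft_compl X A U)) \<longleftrightarrow> soft_mem A x U"
    if "x \<in> X" for U x
    using that by (auto simp: soft_mem_def soft_compl_def)
  have cover: "soft_subset A (soft_compl X A U) H \<longleftrightarrow> (\<forall>a\<in>A. \<forall>y\<in>X. y \<in> U a \<or> y \<in> H a)"
    for U H
    by (auto simp: soft_subset_def soft_compl_def)
  have disjoint: "soft_inter A G H = soft_empty A \<longleftrightarrow>
      (\<forall>a\<in>A. \<forall>y\<in>X. \<not> (y \<in> G a \<and> y \<in> H a))" if "G \<in> T" for G H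
  proof -
    have "G a \<subseteq> X" if "a \<in> A" for a
      using assms \<open>G \<in> T\<close> that by (auto simp: soft_sets_def)
    moreover have "soft_inter A G H = soft_empty A \<longleftrightarrow> (\<forall>a\<in>A. G a \<inter> H a = {})"
      by (auto simp: soft_inter_def soft_empty_def restrict_def fun_eq_iff)
    ultimately show ?thesis by blast
  qed
  have "soft_k_regular X A T \<longleftrightarrow>
    (\<forall>U\<in>T. \<forall>x\<in>X. soft_mem A x (soft_compl X A (soft_compl X A U)) \<longrightarrow>
      (\<exists>G\<in>T. \<exists>H\<in>T. soft_mem A x G \<and> soft_subset A (soft_compl X A U) H \<and>
        soft_inter A G H = soft_empty A))"
    by (auto simp: soft_k_regular_def soft_closed_def)
  then show ?thesis
    by (simp add: mem cover disjoint ball_conj_distrib flip: soft_mem_def)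
qed

text \<open>By the previous lemma, regularity speaks only about which points lie in which soft open
  sets at which parameters. Taking preimages preserves this incidence, and since \<open>r\<close> is
  surjective, a statement about all points of the codomain is one about all \<open>r x\<close>.\<close>

lemma soft_k_regular_preimage_iff:
  assumes "T' \<subseteq> soft_sets (r ` X) A"
  shows "soft_k_regular X A (soft_preimage X A r ` T') \<longleftrightarrow> soft_k_regular (r ` X) A T'"
proof -
  have sub: "soft_preimage X A r ` T' \<subseteq> soft_sets X A"
    by (auto simp: soft_preimage_def soft_sets_def)
  have mem: "x \<in> soft_preimage X A r F a \<longleftrightarrow> r x \<in> F a" if "a \<in> A" "x \<in> X" for x a F
    using that by (simp add: soft_preimage_def)
  show ?thesis
    unfolding soft_k_regular_iff_open[OF sub] soft_k_regular_iff_open[OF assms]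
    by (simp add: mem)
qed

lemma T0_points_eq_image: "T0_points X A T = T0_proj X A T ` X"
  by (auto simp: T0_points_def T0_proj_def quotient_def)

text \<open>Preimages of members of the reflection topology are open by definition. Conversely, the
  parameterwise image of an open \<open>U\<close> has preimage \<open>U\<close>, because \<open>T\<^sub>0\<^sub>U\<close> makes \<open>U\<close> saturated
  at every parameter.\<close>

lemma soft_preimage_T0_topology:
  assumes top: "soft_topology X A T" and T0U: "soft_T0U X A T"
  shows "soft_preimage X A (T0_proj X A T) ` T0_topology X A T = T"
proof
  show "soft_preimage X A (T0_proj X A T) ` T0_topology X A T \<subseteq> T"
    by (auto simp: T0_topology_def soft_preimage_def)
  show "T \<subseteq> soft_preimage X A (T0_proj X A T) ` T0_topology X A T"
  proof
    fix U assume U: "U \<in> T"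
    then have U_sets: "U \<in> soft_sets X A"
      using top by (auto simp: soft_topology_def)
    then have U_sub: "U a \<subseteq> X" if "a \<in> A" for a
      using that by (auto simp: soft_sets_def)
    have saturated: "x \<in> U a"
      if "a \<in> A" "x \<in> X" "y \<in> U a" "T0_proj X A T x = T0_proj X A T y" for a x y
    proof -
      have "y \<in> X" using U_sub that by blast
      then have "(x, y) \<in> soft_indist_rel X A T"
        using that eq_equiv_class_iff[OF equiv_soft_indist_rel[OF top]]
        by (simp add: T0_proj_def)
      then have "soft_indist X A T x y"
        by (simp add: soft_indist_rel_def)
      then show ?thesis
        using T0U U that \<open>y \<in> X\<close> by (auto simp: soft_T0U_def)
    qed
    define V where "V = (\<lambda>a\<in>A. T0_proj X A T ` U a)"
    have pre: "soft_preimage X A (T0_proj X A T) V = U"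
    proof
      fix a
      show "soft_preimage X A (T0_proj X A T) V a = U a"
      proof (cases "a \<in> A")
        case True
        then show ?thesis
          using U_sub saturated by (auto simp: soft_preimage_def V_def)
      next
        case False
        then show ?thesis
          using U_sets by (auto simp: soft_preimage_def soft_sets_def)
      qed
    qed
    have "V \<in> soft_sets (T0_points X A T) A"
      using U_sub by (auto simp: V_def soft_sets_def T0_points_eq_image)
    with pre U have "V \<in> T0_topology X A T"
      by (simp add: T0_topology_def soft_preimage_def)
    with pre show "U \<in> soft_preimage X A (T0_proj X A T) ` T0_topology X A T"
      by blast
  qed
qed

theorem proposition4p6:
  fixes X :: "'a set" and A :: "'p set" and T :: "('p \<Rightarrow> 'a set) set"
  assumes "soft_topology X A T"
    and "soft_T0U X A T"
  shows "soft_T03k X A T \<longleftrightarrow> soft_T01k X A T \<and> soft_k_regular X A T"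
proof -
  have "T0_topology X A T \<subseteq> soft_sets (T0_proj X A T ` X) A"
    by (auto simp: T0_topology_def T0_points_eq_image)
  from soft_k_regular_preimage_iff[OF this]
  have "soft_k_regular X A T \<longleftrightarrow> soft_k_regular (T0_points X A T) A (T0_topology X A T)"
    by (simp add: soft_preimage_T0_topology[OF assms] T0_points_eq_image)
  then show ?thesis
    by (auto simp: soft_T03k_def soft_T3k_def soft_T01k_def)
qed

end
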